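(* Let $n_\mathcal{G}\ge 1$ and $1\le k_\mathcal{G}\le n_\mathcal{G}$ be integers, let $V(\mathcal{G})$ be a set of $n_\mathcal{G}$ vertices and $D_\mathcal{G}\subseteq V(\mathcal{G})$ a fixed subset of size $k_\mathcal{G}$. Let $I_\mathcal{G}$ be the ideal defined below and let $\mathcal{G}$ be the class of all (simple, undirected) graphs $G$ with vertex set $V(\mathcal{G})$ such that $D_\mathcal{G}$ is a minimum dominating set of $G$ (so $\gamma(G)=k_\mathcal{G}$). Then the points of the variety $\mathcal{V}(I_\mathcal{G})$ are in bijection with the graphs in $\mathcal{G}$, a point $e^\ast$ corresponding to the graph whose edges are the pairs $\{g,g'\}$ with $e^\ast_{gg'}=1$.
   Context: $\mathbb{K}$ is a subfield of $\mathbb{R}$. For each 2-element subset $\{g,g'\}\subseteq V(\mathcal{G})$ there is a variable $e_{gg'}=e_{g'g}$; $P_\mathcal{G}=\mathbb{K}[e_{gg'}:\{g,g'\}\subseteq V(\mathcal{G})]$ (no variables if $n_\mathcal{G}=1$). The ideal $I_\mathcal{G}\subseteq P_\mathcal{G}$ is generated by: $e_{gg'}^2-e_{gg'}$ for all $\{g,g'\}\subseteq V(\mathcal{G})$; $\prod_{g'\in D_\mathcal{G}}(1-e_{gg'})$ for all $g\in V(\mathcal{G})\setminus D_\mathcal{G}$; and $\prod_{g'\in V(\mathcal{G})\setminus S}\big(\sum_{g\in S}e_{gg'}\big)$ for all $S\subseteq V(\mathcal{G})$ with $|S|=k_\mathcal{G}-1$. The variety $\mathcal{V}(I)$ of an ideal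 $I$ is the set of common zeros of all polynomials in $I$ with coordinates in the algebraic closure $\overline{\mathbb{K}}$. A set $D$ of vertices is dominating if every vertex outside $D$ is adjacent to some vertex of $D$; $\gamma(G)$ is the minimum size of a dominating set. *)

theory Defs
  imports Complex_Main "HOL-Library.Poly_Mapping" "HOL-Library.FuncSet"
    "HOL-Algebra.Algebraic_Closure_Type"
begin

section \<open>Graphs and domination\<close>

text \<open>A simple undirected graph is a pair of a vertex set and a set of 2-element subsets of it.\<close>

type_synonym 'a ugraph = "'a set \<times> 'a set set"

definition pairs :: "'a set \<Rightarrow> 'a set set" where
  "pairs V = {e. e \<subseteq> V \<and> card e = 2}"

definition simple_graph :: "'a ugraph \<Rightarrow> bool" where
  "simple_graph G \<longleftrightarrow> snd G \<subseteq> pairs (fst G)"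

definition dominating_set :: "'a ugraph \<Rightarrow> 'a set \<Rightarrow> bool" where
  "dominating_set G D \<longleftrightarrow>
     D \<subseteq> fst G \<and> (\<forall>v \<in> fst G - D. \<exists>u \<in> D. {u, v} \<in> snd G)"

definition domination_number :: "'a ugraph \<Rightarrow> nat" where
  "domination_number G = Min (card ` {D. dominating_set G D})"

definition minimum_dominating_set :: "'a ugraph \<Rightarrow> 'a set \<Rightarrow> bool" where
  "minimum_dominating_set G D \<longleftrightarrow>
     dominating_set G D \<and> (\<forall>D'. dominating_set G D' \<longrightarrow> card D \<le> card D')"

definition graph_class :: "'a set \<Rightarrow> 'a set \<Rightarrow> 'a ugraph set" where
  "graph_class V D = {G. simple_graph G \<and> fst G = V \<and> minimum_dominating_set G D}"

section \<open>Polynomials over a subfield of the reals\<close>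

text \<open>A polynomial maps monomials (finitely supported exponent functions) to coefficients.
  Coefficients are real at the type level; \<open>poly_ring_over K Vs\<close> below singles out the
  polynomials with coefficients in \<open>K\<close> and variables in \<open>Vs\<close>.\<close>

type_synonym 'v mpoly = "('v \<Rightarrow>\<^sub>0 nat) \<Rightarrow>\<^sub>0 real"

definition Var :: "'v \<Rightarrow> 'v mpoly" where
  "Var x = Poly_Mapping.single (Poly_Mapping.single x 1) 1"

definition poly_ring_over :: "real set \<Rightarrow> 'v set \<Rightarrow> 'v mpoly ring" where
  "poly_ring_over K Vs = ring_of_type_algebra
     \<lparr>carrier := {p. (\<forall>m. Poly_Mapping.lookup p m \<in> K) \<and>
                     (\<forall>m \<in> Poly_Mapping.keys p. Poly_Mapping.keys m \<subseteq> Vs)}\<rparr>"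

definition eval_mpoly :: "('v \<Rightarrow> complex) \<Rightarrow> 'v mpoly \<Rightarrow> complex" where
  "eval_mpoly z p = (\<Sum>m \<in> Poly_Mapping.keys p.
     of_real (Poly_Mapping.lookup p m) *
       (\<Prod>x \<in> Poly_Mapping.keys m. z x ^ Poly_Mapping.lookup m x))"

text \<open>Since \<open>K\<close> is a subfield of the reals, the complex numbers algebraic over \<open>K\<close> form an
  algebraic closure of \<open>K\<close>.\<close>

definition alg_closure_of :: "real set \<Rightarrow> complex set" where
  "alg_closure_of K =
     {z. (ring.algebraic (ring_of_type_algebra :: complex ring) over (complex_of_real ` K)) z}"

text \<open>Points have one coordinate for each variable in \<open>Vs\<close>; outside \<open>Vs\<close> they are
  \<open>undefined\<close>, so that distinct functions are distinct points.\<close>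

definition variety :: "real set \<Rightarrow> 'v set \<Rightarrow> 'v mpoly set \<Rightarrow> ('v \<Rightarrow> complex) set" where
  "variety K Vs I = {z \<in> Vs \<rightarrow>\<^sub>E alg_closure_of K. \<forall>p \<in> I. eval_mpoly z p = 0}"

section \<open>The domination ideal\<close>

definition domination_gens :: "'a set \<Rightarrow> 'a set \<Rightarrow> nat \<Rightarrow> 'a set mpoly set" where
  "domination_gens V D k =
     {Var e ^ 2 - Var e | e. e \<in> pairs V} \<union>
     {\<Prod>g' \<in> D. (1 - Var {g, g'}) | g. g \<in> V - D} \<union>
     {\<Prod>g' \<in> V - S. (\<Sum>g \<in> S. Var {g, g'}) | S. S \<subseteq> V \<and> card S = k - 1}"

definition domination_ideal :: "real set \<Rightarrow> 'a set \<Rightarrow> 'a set \<Rightarrow> nat \<Rightarrow> 'a set mpoly set" where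
  "domination_ideal K V D k = genideal (poly_ring_over K (pairs V)) (domination_gens V D k)"

definition graph_of_point :: "'a set \<Rightarrow> ('a set \<Rightarrow> complex) \<Rightarrow> 'a ugraph" where
  "graph_of_point V z = (V, {e \<in> pairs V. z e = 1})"

end

(* Evaluation at a point is a ring homomorphism, so its kernel is an ideal and the variety is the set
   of common zeros of the generators. The first family forces coordinates in {0,1}, the second says
   that D dominates. At a 0/1 point the sum over S vanishes only if every summand does, so the
   third family says that no set of size k - 1 dominates; since supersets of dominating sets
   dominate, this excludes all sizes below k. *)

theory Submission
  imports Defs
begin

section \<open>Evaluation of polynomials\<close>

text \<open>Updating a key outside the support amounts to adding a single term. Additive functions
  of a polynomial are therefore determined by their values on single terms.\<close>

lemma poly_mapping_single_add_induct [case_names zero add]: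
  fixes p :: "'a \<Rightarrow>\<^sub>0 'b::comm_monoid_add"
  assumes zero: "P 0"
    and add: "\<And>a b f. P f \<Longrightarrow> P (Poly_Mapping.single a b + f)"
  shows "P p"
proof (induction p rule: update_induct)
  case const
  show ?case by (rule zero)
next
  case (update f a b)
  have "Poly_Mapping.update a b f = Poly_Mapping.single a b + f"
    using update(1)
    by (intro poly_mapping_eqI) (auto simp: lookup_update lookup_add lookup_single when_def in_keys_iff)
  with add[OF update(3)] show ?case by simp
qed

text \<open>The inner product of \<open>eval_mpoly\<close> gets its own name so that
  multiplicativity on monomials can be treated apart from the coefficients.\<close>

definition eval_monomial :: "('v \<Rightarrow> complex) \<Rightarrow> ('v \<Rightarrow>\<^sub>0 nat) \<Rightarrow> complex" where
  "eval_monomial z m = (\<Prod>x \<in> Poly_Mapping.keys m. z x ^ Poly_Mapping.lookup m x)"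

text \<open>Outside the support the exponent is 0 and the factor is 1. Monomials with different
  supports can thus be compared over one index set.\<close>

lemma eval_monomial_superset:
  assumes "finite A" "Poly_Mapping.keys m \<subseteq> A"
  shows "eval_monomial z m = (\<Prod>x\<in>A. z x ^ Poly_Mapping.lookup m x)"
  unfolding eval_monomial_def using assms
  by (intro prod.mono_neutral_left) (auto simp: in_keys_iff)

lemma eval_monomial_add: "eval_monomial z (m + m') = eval_monomial z m * eval_monomial z m'"
proof -
  let ?A = "Poly_Mapping.keys m \<union> Poly_Mapping.keys m'"
  have "eval_monomial z (m + m') = (\<Prod>x\<in>?A. z x ^ Poly_Mapping.lookup (m + m') x)"
    by (rule eval_monomial_superset) (auto simp: Poly_Mapping.keys_add)
  also have "\<dots> = (\<Prod>x\<in>?A. z x ^ Poly_Mapping.lookup m x) * (\<Prod>x\<in>?A. z x ^ Poly_Mapping.lookup m' x)"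
    by (simp add: lookup_add power_add prod.distrib)
  also have "\<dots> = eval_monomial z m * eval_monomial z m'"
    by (simp add: eval_monomial_superset[of ?A m] eval_monomial_superset[of ?A m'])
  finally show ?thesis .
qed

lemma eval_mpoly_eq:
  "eval_mpoly z p = (\<Sum>m \<in> Poly_Mapping.keys p. of_real (Poly_Mapping.lookup p m) * eval_monomial z m)"
  by (simp add: eval_mpoly_def eval_monomial_def)

lemma eval_mpoly_zero [simp]: "eval_mpoly z 0 = 0"
  by (simp add: eval_mpoly_def)

lemma eval_mpoly_one [simp]: "eval_mpoly z 1 = 1"
  by (simp add: eval_mpoly_def)

lemma eval_mpoly_single: "eval_mpoly z (Poly_Mapping.single m c) = of_real c * eval_monomial z m"
  by (simp add: eval_mpoly_eq)

lemma eval_mpoly_Var [simp]: "eval_mpoly z (Var x) = z x"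
  by (simp add: Var_def eval_mpoly_single eval_monomial_def)

lemma eval_mpoly_add [simp]: "eval_mpoly z (p + q) = eval_mpoly z p + eval_mpoly z q"
  \<comment> \<open>Cancellation may remove keys from \<open>p + q\<close>. This is harmless,
    because each summand is additive in the coefficient and vanishes at coefficient 0.\<close>
  unfolding eval_mpoly_eq by (rule setsum_keys_plus_distrib) (auto simp: algebra_simps)

lemma eval_mpoly_uminus [simp]: "eval_mpoly z (- p) = - eval_mpoly z p"
  using eval_mpoly_add[of z p "- p"] by (simp add: eq_neg_iff_add_eq_0 add.commute)

lemma eval_mpoly_diff [simp]: "eval_mpoly z (p - q) = eval_mpoly z p - eval_mpoly z q"
  using eval_mpoly_add[of z p "- q"] by simp

text \<open>Both sides are additive in each factor, so nested inductions on \<open>p\<close> and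
  \<open>q\<close> reduce the claim to two single terms, where \<open>eval_monomial_add\<close>
  applies.\<close>

lemma eval_mpoly_mult [simp]: "eval_mpoly z (p * q) = eval_mpoly z p * eval_mpoly z q"
proof (induction p rule: poly_mapping_single_add_induct)
  case (add m c f)
  have "eval_mpoly z (Poly_Mapping.single m c * q) = of_real c * eval_monomial z m * eval_mpoly z q"
    by (induction q rule: poly_mapping_single_add_induct)
      (simp_all add: distrib_left mult_single eval_mpoly_single eval_monomial_add)
  with add show ?case
    by (simp add: distrib_right eval_mpoly_single)
qed simp

lemma eval_mpoly_power [simp]: "eval_mpoly z (p ^ n) = eval_mpoly z p ^ n"
  by (induction n) auto

lemma eval_mpoly_sum [simp]: "eval_mpoly z (sum f A) = (\<Sum>x\<in>A. eval_mpoly z (f x))"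
  by (induction A rule: infinite_finite_induct) auto

lemma eval_mpoly_prod [simp]: "eval_mpoly z (prod f A) = (\<Prod>x\<in>A. eval_mpoly z (f x))"
  by (induction A rule: infinite_finite_induct) auto

section \<open>The polynomial ring over a subring\<close>

lemma ring_of_type_algebra_simps [simp]:
  "carrier ring_of_type_algebra = UNIV"
  "x \<otimes>\<^bsub>ring_of_type_algebra\<^esub> y = x * y"
  "x \<oplus>\<^bsub>ring_of_type_algebra\<^esub> y = x + y"
  "\<zero>\<^bsub>ring_of_type_algebra\<^esub> = 0"
  "\<one>\<^bsub>ring_of_type_algebra\<^esub> = 1"
  by (simp_all add: ring_of_type_algebra_def)

text \<open>The negative is not a field of the ring record but derived from addition, so it is
  identified through uniqueness of additive inverses.\<close>

lemma a_inv_ring_of_type_algebra [simp]: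
  "\<ominus>\<^bsub>ring_of_type_algebra\<^esub> (x :: 'a::comm_ring_1) = - x"
proof -
  interpret ring "ring_of_type_algebra :: 'a ring" by (rule ring_from_type_algebra)
  show ?thesis by (rule minus_equality) simp_all
qed

lemma subring_of_type_algebraD:
  fixes K :: "'a::comm_ring_1 set"
  assumes "subring K ring_of_type_algebra"
  shows "0 \<in> K" "1 \<in> K" "x \<in> K \<Longrightarrow> - x \<in> K"
    "x \<in> K \<Longrightarrow> y \<in> K \<Longrightarrow> x + y \<in> K" "x \<in> K \<Longrightarrow> y \<in> K \<Longrightarrow> x * y \<in> K"
  using subringE(2,3,5,6,7)[OF assms] by simp_all

lemma subring_of_type_algebraI:
  fixes K :: "'a::comm_ring_1 set"
  assumes "1 \<in> K" "\<And>x. x \<in> K \<Longrightarrow> - x \<in> K"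
    "\<And>x y. x \<in> K \<Longrightarrow> y \<in> K \<Longrightarrow> x + y \<in> K" "\<And>x y. x \<in> K \<Longrightarrow> y \<in> K \<Longrightarrow> x * y \<in> K"
  shows "subring K ring_of_type_algebra"
proof -
  interpret ring "ring_of_type_algebra :: 'a ring" by (rule ring_from_type_algebra)
  show ?thesis by (rule subringI) (simp_all add: assms)
qed

text \<open>For infinite \<open>A\<close> the sum is 0 by convention, and 0 lies in
  \<open>K\<close>; the product version uses 1 in the same way.\<close>

lemma sum_in_subring:
  fixes K :: "'a::comm_ring_1 set"
  assumes "subring K ring_of_type_algebra" "\<And>x. x \<in> A \<Longrightarrow> f x \<in> K"
  shows "sum f A \<in> K"
  using assms(2) subring_of_type_algebraD[OF assms(1)]
  by (induction A rule: infinite_finite_induct) auto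

lemma prod_in_subring:
  fixes K :: "'a::comm_ring_1 set"
  assumes "subring K ring_of_type_algebra" "\<And>x. x \<in> A \<Longrightarrow> f x \<in> K"
  shows "prod f A \<in> K"
  using assms(2) subring_of_type_algebraD[OF assms(1)]
  by (induction A rule: infinite_finite_induct) auto

lemma carrier_poly_ring_over:
  "carrier (poly_ring_over K Vs) = {p. (\<forall>m. Poly_Mapping.lookup p m \<in> K) \<and>
     (\<forall>m \<in> Poly_Mapping.keys p. Poly_Mapping.keys m \<subseteq> Vs)}"
  by (simp add: poly_ring_over_def)

lemma subring_poly_ring_over:
  assumes K: "subring K (ring_of_type_algebra :: real ring)"
  shows "subring (carrier (poly_ring_over K Vs)) (ring_of_type_algebra :: 'v mpoly ring)"
proof (rule subring_of_type_algebraI)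
  note K_closed = subring_of_type_algebraD[OF K]
  show "1 \<in> carrier (poly_ring_over K Vs)"
    using K_closed(1,2) by (simp add: carrier_poly_ring_over lookup_one when_def)
  fix p q :: "'v mpoly"
  assume p: "p \<in> carrier (poly_ring_over K Vs)"
  then show "- p \<in> carrier (poly_ring_over K Vs)"
    using K_closed(3) by (simp add: carrier_poly_ring_over)
  assume q: "q \<in> carrier (poly_ring_over K Vs)"
  have "Poly_Mapping.lookup (p + q) m \<in> K" for m
    using p q K_closed(4) by (simp add: carrier_poly_ring_over lookup_add)
  moreover have "Poly_Mapping.keys m \<subseteq> Vs" if "m \<in> Poly_Mapping.keys (p + q)" for m
  proof -
    from that have "m \<in> Poly_Mapping.keys p \<or> m \<in> Poly_Mapping.keys q"
      using Poly_Mapping.keys_add[of p q] by blast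
    with p q show ?thesis by (auto simp: carrier_poly_ring_over)
  qed
  ultimately show "p + q \<in> carrier (poly_ring_over K Vs)"
    by (simp add: carrier_poly_ring_over)
  \<comment> \<open>The convolution formula for coefficients of \<open>p * q\<close> contains
    \<open>when\<close>, whose default value 0 must also lie in \<open>K\<close>.\<close>
  have when_K: "(x when b) \<in> K" if "x \<in> K" for x b
    using that K_closed(1) by (simp add: when_def)
  have "Poly_Mapping.lookup (p * q) m \<in> K" for m
    unfolding lookup_mult Sum_any.expand_set
    using p q
    by (intro sum_in_subring[OF K] K_closed(5) when_K) (simp_all add: carrier_poly_ring_over)
  moreover have "Poly_Mapping.keys m \<subseteq> Vs" if "m \<in> Poly_Mapping.keys (p * q)" for m
  proof -
    from that obtain a b where "m = a + b" "a \<in> Poly_Mapping.keys p" "b \<in> Poly_Mapping.keys q"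
      using keys_mult[of p q] by blast
    with p q show ?thesis
      using Poly_Mapping.keys_add[of a b] unfolding carrier_poly_ring_over by blast
  qed
  ultimately show "p * q \<in> carrier (poly_ring_over K Vs)"
    by (simp add: carrier_poly_ring_over)
qed

lemma Var_in_poly_ring_over:
  assumes "subring K (ring_of_type_algebra :: real ring)" "x \<in> Vs"
  shows "Var x \<in> carrier (poly_ring_over K Vs)"
  using assms(2) subring_of_type_algebraD(1,2)[OF assms(1)]
  by (simp add: carrier_poly_ring_over Var_def lookup_single when_def)

text \<open>This exhibits the ring as a carrier update of the ambient ring by a named subring, the
  form in which \<open>subring_is_ring\<close> applies.\<close>

lemma poly_ring_over_eq:
  "poly_ring_over K Vs = ring_of_type_algebra\<lparr>carrier := carrier (poly_ring_over K Vs)\<rparr>"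
  by (simp add: poly_ring_over_def)

lemma eval_mpoly_ring_hom:
  assumes "subring K (ring_of_type_algebra :: real ring)"
  shows "ring_hom_ring (poly_ring_over K Vs) ring_of_type_algebra (eval_mpoly z)"
proof (rule ring_hom_ringI2)
  show "ring (poly_ring_over K Vs)"
    by (subst poly_ring_over_eq)
      (rule ring.subring_is_ring[OF ring_from_type_algebra subring_poly_ring_over[OF assms]])
  show "eval_mpoly z \<in> ring_hom (poly_ring_over K Vs) ring_of_type_algebra"
    by (rule ring_hom_memI) (simp_all add: poly_ring_over_def)
qed (rule ring_from_type_algebra)

section \<open>Varieties of generated ideals and algebraic coordinates\<close>

lemma variety_genideal:
  assumes K: "subring K (ring_of_type_algebra :: real ring)"
    and B: "B \<subseteq> carrier (poly_ring_over K Vs)"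
  shows "variety K Vs (genideal (poly_ring_over K Vs) B) = variety K Vs B"
proof -
  have "(\<forall>p \<in> genideal (poly_ring_over K Vs) B. eval_mpoly z p = 0) \<longleftrightarrow> (\<forall>p \<in> B. eval_mpoly z p = 0)"
    for z
  proof -
    interpret ring_hom_ring "poly_ring_over K Vs" ring_of_type_algebra "eval_mpoly z"
      by (rule eval_mpoly_ring_hom[OF K])
    have kernel: "ideal {p \<in> carrier (poly_ring_over K Vs). eval_mpoly z p = 0} (poly_ring_over K Vs)"
      using kernel_is_ideal unfolding a_kernel_def' ring_of_type_algebra_simps .
    \<comment> \<open>The kernel consists of carrier elements only. Inclusion in it therefore means
      vanishing of every element just for sets that lie in the carrier, such as \<open>B\<close> and
      its ideal.\<close>
    have carrier: "genideal (poly_ring_over K Vs) B \<subseteq> carrier (poly_ring_over K Vs)"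
      using ideal.Icarr[OF R.genideal_ideal[OF B]] by blast
    show ?thesis
      using R.Idl_subset_ideal[OF kernel B] B carrier by blast
  qed
  then show ?thesis by (simp add: variety_def)
qed

text \<open>Elements of a base ring are algebraic over it. Every point of the variety turns out to
  have coordinates 0 and 1, so this is the only fact about the algebraic closure that is called
  for.\<close>

lemma alg_closure_of_01:
  assumes "subring K (ring_of_type_algebra :: real ring)"
  shows "{0, 1} \<subseteq> alg_closure_of K"
proof -
  note K = subring_of_type_algebraD[OF assms]
  interpret field "ring_of_type_algebra :: complex ring" by (rule field_from_type_algebra)
  have "subring (complex_of_real ` K) ring_of_type_algebra"
  proof (rule subring_of_type_algebraI)
    show "1 \<in> complex_of_real ` K"
      using K(2) by (rule rev_image_eqI) simp
  qed (use K in \<open>auto simp flip: of_real_minus of_real_add of_real_mult\<close>)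
  from algebraic_self[OF this, OF imageI[OF K(1)]] algebraic_self[OF this, OF imageI[OF K(2)]]
  show ?thesis by (simp add: alg_closure_of_def)
qed

section \<open>The domination ideal\<close>

lemma edge_in_pairs: "a \<in> V \<Longrightarrow> b \<in> V \<Longrightarrow> a \<noteq> b \<Longrightarrow> {a, b} \<in> pairs V"
  by (simp add: pairs_def)

text \<open>Every variable in the second and third families joins a vertex inside \<open>D\<close>
  or \<open>S\<close> to one outside, so its index is a genuine 2-element set.\<close>

lemma domination_gens_subset:
  assumes K: "subring K (ring_of_type_algebra :: real ring)" and "D \<subseteq> V"
  shows "domination_gens V D k \<subseteq> carrier (poly_ring_over K (pairs V))"
proof -
  let ?R = "carrier (poly_ring_over K (pairs V))"
  note R = subring_poly_ring_over[OF K, where Vs = "pairs V"]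
  note R_closed = subring_of_type_algebraD[OF R]
  have minus: "p - q \<in> ?R" if "p \<in> ?R" "q \<in> ?R" for p q
    using R_closed(4)[OF that(1) R_closed(3)[OF that(2)]] by simp
  note Var = Var_in_poly_ring_over[OF K, where Vs = "pairs V"]
  show ?thesis
  proof
    fix p :: "'a set mpoly"
    assume "p \<in> domination_gens V D k"
    then consider e where "e \<in> pairs V" "p = Var e ^ 2 - Var e"
      | g where "g \<in> V - D" "p = (\<Prod>g' \<in> D. 1 - Var {g, g'})"
      | S where "S \<subseteq> V" "p = (\<Prod>g' \<in> V - S. \<Sum>g \<in> S. Var {g, g'})"
      unfolding domination_gens_def by blast
    then show "p \<in> ?R"
    proof cases
      case 1
      then show ?thesis
        unfolding power2_eq_square by (simp add: minus R_closed(5) Var)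
    next
      case 2
      have "Var {g, g'} \<in> ?R" if "g' \<in> D" for g'
        using that 2(1) \<open>D \<subseteq> V\<close> by (intro Var edge_in_pairs) auto
      with 2(2) show ?thesis
        by (simp add: prod_in_subring[OF R] minus R_closed(2))
    next
      case 3
      have "Var {g, g'} \<in> ?R" if "g \<in> S" "g' \<in> V - S" for g g'
        using that 3(1) by (intro Var edge_in_pairs) auto
      then have "(\<Sum>g \<in> S. Var {g, g'}) \<in> ?R" if "g' \<in> V - S" for g'
        using that by (intro sum_in_subring[OF R]) blast
      then show ?thesis
        unfolding 3(2) by (rule prod_in_subring[OF R])
    qed
  qed
qed

section \<open>Points with 0/1 coordinates and domination\<close>

lemma sum_01_eq_0_iff:
  fixes f :: "'b \<Rightarrow> complex"
  assumes "finite S" "\<And>x. x \<in> S \<Longrightarrow> f x \<in> {0, 1}"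
  shows "sum f S = 0 \<longleftrightarrow> (\<forall>x\<in>S. f x = 0)"
proof -
  \<comment> \<open>The sum counts the indices with value 1; in characteristic 0 this count vanishes
    only if there are none.\<close>
  define T where "T = {x \<in> S. f x = 1}"
  have "sum f S = (\<Sum>x\<in>T. 1)"
    unfolding T_def using assms by (intro sum.mono_neutral_cong_right) auto
  moreover have "finite T" using assms(1) by (simp add: T_def)
  ultimately have "sum f S = 0 \<longleftrightarrow> T = {}" by simp
  also have "\<dots> \<longleftrightarrow> (\<forall>x\<in>S. f x = 0)"
    using assms(2) by (force simp: T_def)
  finally show ?thesis .
qed

text \<open>Edges of \<open>graph_of_point\<close> must also lie in \<open>pairs V\<close>, which is
  automatic between \<open>S\<close> and its complement.\<close>

lemma dominating_graph_of_point:
  assumes "S \<subseteq> V"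
  shows "dominating_set (graph_of_point V z) S \<longleftrightarrow> (\<forall>v \<in> V - S. \<exists>u \<in> S. z {u, v} = 1)"
proof -
  have "{u, v} \<in> pairs V" if "u \<in> S" "v \<in> V - S" for u v
    using that assms by (auto intro: edge_in_pairs)
  with assms show ?thesis
    unfolding dominating_set_def graph_of_point_def by auto
qed

lemma variety_domination_ideal:
  assumes K: "subring K (ring_of_type_algebra :: real ring)"
    and V: "finite V" and D: "D \<subseteq> V"
  shows "z \<in> variety K (pairs V) (domination_ideal K V D k) \<longleftrightarrow>
    z \<in> pairs V \<rightarrow>\<^sub>E {0, 1} \<and> dominating_set (graph_of_point V z) D \<and>
    (\<forall>S. S \<subseteq> V \<and> card S = k - 1 \<longrightarrow> \<not> dominating_set (graph_of_point V z) S)"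
proof -
  have fin: "finite S" if "S \<subseteq> V" for S using that V by (rule finite_subset)
  have 1: "(\<forall>e \<in> pairs V. z e ^ 2 - z e = 0) \<longleftrightarrow> (\<forall>e \<in> pairs V. z e \<in> {0, 1})"
    by (auto simp: power2_eq_square)
  \<comment> \<open>A finite product vanishes iff some factor does. The generators name the outside
    vertex first and \<open>dominating_set\<close> names it last, hence
    \<open>insert_commute\<close>.\<close>
  have 2: "(\<forall>g \<in> V - D. (\<Prod>g'\<in>D. 1 - z {g, g'}) = 0) \<longleftrightarrow> dominating_set (graph_of_point V z) D"
    using fin[OF D] by (auto simp: dominating_graph_of_point[OF D] insert_commute)
  have 3: "(\<Prod>g' \<in> V - S. \<Sum>g\<in>S. z {g, g'}) = 0 \<longleftrightarrow> \<not> dominating_set (graph_of_point V z) S"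
    if z: "\<forall>e \<in> pairs V. z e \<in> {0, 1}" and S: "S \<subseteq> V" for S
  proof -
    have z01: "z {g, g'} \<in> {0, 1}" if "g \<in> S" "g' \<in> V - S" for g g'
    proof -
      have "{g, g'} \<in> pairs V" using that S by (auto intro: edge_in_pairs)
      with z show ?thesis by blast
    qed
    have "(\<Prod>g' \<in> V - S. \<Sum>g\<in>S. z {g, g'}) = 0 \<longleftrightarrow> (\<exists>g' \<in> V - S. (\<Sum>g\<in>S. z {g, g'}) = 0)"
      using V by simp
    also have "\<dots> \<longleftrightarrow> (\<exists>g' \<in> V - S. \<forall>g\<in>S. z {g, g'} = 0)"
      using sum_01_eq_0_iff[OF fin[OF S] z01] by simp
    also have "\<dots> \<longleftrightarrow> (\<exists>g' \<in> V - S. \<forall>g\<in>S. z {g, g'} \<noteq> 1)"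
    proof (intro bex_cong ball_cong refl)
      fix g g' assume "g' \<in> V - S" "g \<in> S"
      with z01[of g g'] show "z {g, g'} = 0 \<longleftrightarrow> z {g, g'} \<noteq> 1" by auto
    qed
    finally show ?thesis by (auto simp: dominating_graph_of_point[OF S])
  qed
  have gens: "(\<forall>p \<in> domination_gens V D k. eval_mpoly z p = 0) \<longleftrightarrow>
      (\<forall>e \<in> pairs V. z e ^ 2 - z e = 0) \<and>
      (\<forall>g \<in> V - D. (\<Prod>g'\<in>D. 1 - z {g, g'}) = 0) \<and>
      (\<forall>S. S \<subseteq> V \<and> card S = k - 1 \<longrightarrow> (\<Prod>g' \<in> V - S. \<Sum>g\<in>S. z {g, g'}) = 0)"
    (is "?L \<longleftrightarrow> _")
  proof -
    \<comment> \<open>The union of set comprehensions is first split into three quantified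
      conditions; only then do the homomorphism rules evaluate the generators.\<close>
    have "?L \<longleftrightarrow> (\<forall>e \<in> pairs V. eval_mpoly z (Var e ^ 2 - Var e) = 0) \<and>
      (\<forall>g \<in> V - D. eval_mpoly z (\<Prod>g'\<in>D. 1 - Var {g, g'}) = 0) \<and>
      (\<forall>S. S \<subseteq> V \<and> card S = k - 1 \<longrightarrow>
        eval_mpoly z (\<Prod>g' \<in> V - S. \<Sum>g\<in>S. Var {g, g'}) = 0)"
      unfolding domination_gens_def by blast
    then show ?thesis by simp
  qed
  have "z \<in> variety K (pairs V) (domination_ideal K V D k) \<longleftrightarrow>
      z \<in> pairs V \<rightarrow>\<^sub>E alg_closure_of K \<and> (\<forall>p \<in> domination_gens V D k. eval_mpoly z p = 0)"
    unfolding domination_ideal_def variety_genideal[OF K domination_gens_subset[OF K D]]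
    by (simp add: variety_def)
  \<comment> \<open>Condition \<open>1\<close> confines the coordinates to 0 and 1, which makes
    \<open>3\<close> applicable. Conversely, such coordinates are algebraic by
    \<open>alg_closure_of_01\<close>.\<close>
  also have "\<dots> \<longleftrightarrow> z \<in> pairs V \<rightarrow>\<^sub>E {0, 1} \<and> dominating_set (graph_of_point V z) D \<and>
    (\<forall>S. S \<subseteq> V \<and> card S = k - 1 \<longrightarrow> \<not> dominating_set (graph_of_point V z) S)"
    unfolding gens 1 2 using alg_closure_of_01[OF K] 3 by (auto simp: PiE_iff)
  finally show ?thesis .
qed

section \<open>Minimum dominating sets\<close>

lemma dominating_set_superset:
  "dominating_set G S \<Longrightarrow> S \<subseteq> T \<Longrightarrow> T \<subseteq> fst G \<Longrightarrow> dominating_set G T"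
  unfolding dominating_set_def by blast

text \<open>A dominating set smaller than \<open>D\<close> can be enlarged to exactly
  \<open>card D - 1\<close> vertices and still dominates, so excluding that single size excludes all
  smaller ones.\<close>

lemma minimum_dominating_set_iff:
  assumes V: "finite (fst G)" and "1 \<le> card D"
  shows "minimum_dominating_set G D \<longleftrightarrow> dominating_set G D \<and>
    (\<forall>S. S \<subseteq> fst G \<and> card S = card D - 1 \<longrightarrow> \<not> dominating_set G S)"
proof
  assume min: "minimum_dominating_set G D"
  have "\<not> dominating_set G S" if "card S = card D - 1" for S
  proof
    assume "dominating_set G S"
    with min have "card D \<le> card S" by (simp add: minimum_dominating_set_def)
    \<comment> \<open>Subtraction is truncated at 0; \<open>1 \<le> card D\<close> makes
      \<open>card D - 1\<close> strictly smaller than \<open>card D\<close>.\<close>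
    with that \<open>1 \<le> card D\<close> show False by simp
  qed
  with min show "dominating_set G D \<and>
    (\<forall>S. S \<subseteq> fst G \<and> card S = card D - 1 \<longrightarrow> \<not> dominating_set G S)"
    by (simp add: minimum_dominating_set_def)
next
  assume *: "dominating_set G D \<and>
    (\<forall>S. S \<subseteq> fst G \<and> card S = card D - 1 \<longrightarrow> \<not> dominating_set G S)"
  have "card D \<le> card S" if S: "dominating_set G S" for S
  proof (rule ccontr)
    assume "\<not> card D \<le> card S"
    then have 1: "card S \<le> card D - 1" by simp
    have "D \<subseteq> fst G" and "S \<subseteq> fst G"
      using * S by (auto simp: dominating_set_def)
    \<comment> \<open>Since \<open>D\<close> fits into the vertex set, there is room for an
      intermediate set of this size.\<close>
    then have 2: "card D - 1 \<le> card (fst G)"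
      using card_mono[OF V, of D] by simp
    obtain T where "S \<subseteq> T" "T \<subseteq> fst G" "card T = card D - 1"
      using exists_subset_between[OF 1 2 \<open>S \<subseteq> fst G\<close> V] by blast
    with * dominating_set_superset[OF S, of T] show False by simp
  qed
  with * show "minimum_dominating_set G D" by (simp add: minimum_dominating_set_def)
qed

text \<open>\<open>Min\<close> is only meaningful on finite sets; here finiteness comes from
  dominating sets being subsets of the finite vertex set.\<close>

lemma domination_number_eq:
  assumes "finite (fst G)" "minimum_dominating_set G D"
  shows "domination_number G = card D"
proof -
  have "{S. dominating_set G S} \<subseteq> Pow (fst G)"
    by (auto simp: dominating_set_def)
  then have "finite {S. dominating_set G S}"
    using assms(1) by (meson finite_Pow_iff finite_subset)
  with assms(2) show ?thesis
    unfolding domination_number_def by (intro Min_eqI) (auto simp: minimum_dominating_set_def)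
qed

section \<open>The correspondence between points and graphs\<close>

lemma bij_betw_graph_of_point:
  "bij_betw (graph_of_point V) (pairs V \<rightarrow>\<^sub>E {0, 1}) {G. simple_graph G \<and> fst G = V}"
\<comment> \<open>The inverse sends a graph to the indicator function of its edge set. Restricting
  it to \<open>pairs V\<close> makes it \<open>undefined\<close> elsewhere, as extensional points
  require.\<close>
proof (rule bij_betw_byWitness[where f' = "\<lambda>G. \<lambda>e \<in> pairs V. of_bool (e \<in> snd G)"])
  show "\<forall>z \<in> pairs V \<rightarrow>\<^sub>E {0, 1}. (\<lambda>e \<in> pairs V. of_bool (e \<in> snd (graph_of_point V z))) = z"
    by (auto simp: graph_of_point_def fun_eq_iff PiE_iff extensional_def)
  show "\<forall>G \<in> {G. simple_graph G \<and> fst G = V}.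
      graph_of_point V (\<lambda>e \<in> pairs V. of_bool (e \<in> snd G)) = G"
    by (auto simp: graph_of_point_def simple_graph_def prod_eq_iff)
qed (auto simp: graph_of_point_def simple_graph_def)

theorem theorem3p4:
  fixes K :: "real set" and V D :: "'a set" and n k :: nat
  assumes "subfield K (ring_of_type_algebra :: real ring)"
    and "1 \<le> n" and "1 \<le> k" and "k \<le> n"
    and "finite V" and "card V = n"
    and "D \<subseteq> V" and "card D = k"
  shows "bij_betw (graph_of_point V)
           (variety K (pairs V) (domination_ideal K V D k)) (graph_class V D)
       \<and> (\<forall>G \<in> graph_class V D. domination_number G = k)"
proof
  \<comment> \<open>\<open>graph_of_point V z\<close> is always simple with vertex set
    \<open>V\<close>, so membership in \<open>graph_class V D\<close> reduces to minimality of
    \<open>D\<close>, which is characterized by size \<open>k - 1\<close> because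
    \<open>card D = k\<close>.\<close>
  have "z \<in> variety K (pairs V) (domination_ideal K V D k) \<longleftrightarrow>
      z \<in> pairs V \<rightarrow>\<^sub>E {0, 1} \<and> graph_of_point V z \<in> graph_class V D" for z
    using assms variety_domination_ideal[OF subfieldE(1)[OF assms(1)] \<open>finite V\<close> \<open>D \<subseteq> V\<close>, of z k]
      minimum_dominating_set_iff[of "graph_of_point V z" D]
    by (auto simp: graph_class_def simple_graph_def graph_of_point_def)
  then have variety: "variety K (pairs V) (domination_ideal K V D k) =
      {z \<in> pairs V \<rightarrow>\<^sub>E {0, 1}. graph_of_point V z \<in> graph_class V D}"
    by blast
  show "bij_betw (graph_of_point V)
      (variety K (pairs V) (domination_ideal K V D k)) (graph_class V D)"
    unfolding variety
  \<comment> \<open>The variety is the preimage of \<open>graph_class V D\<close> under the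
    bijection from 0/1 points to simple graphs. It remains to see that its image is the whole class,
    by surjectivity.\<close>
  proof (rule bij_betw_subset[OF bij_betw_graph_of_point[of V]])
    have "graph_class V D \<subseteq> graph_of_point V ` (pairs V \<rightarrow>\<^sub>E {0, 1})"
      using bij_betw_graph_of_point[of V] by (auto simp: bij_betw_def graph_class_def)
    then show "graph_of_point V ` {z \<in> pairs V \<rightarrow>\<^sub>E {0, 1}. graph_of_point V z \<in> graph_class V D}
        = graph_class V D"
      by auto
  qed blast
  show "\<forall>G \<in> graph_class V D. domination_number G = k"
    using assms domination_number_eq by (auto simp: graph_class_def)
qed

end
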